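(* Let $(\Delta,X)$ be a strong combinatorial grape. Then $\Delta$ is simple-homotopy equivalent either to the void complex or to $\partial\beta_n$, the boundary of the $n$-dimensional cross-polytope, for some integer $n\ge 0$.
   Context: A simplicial complex is a pair $(\Delta,X)$ (often written just $\Delta$), where $X$ is a finite set (the ground set) and $\Delta$ is a family of subsets of $X$ closed under taking subsets. Elements of $\Delta$ are faces; $x\in X$ is a vertex of $\Delta$ if $\{x\}\in\Delta$ (not every element of $X$ need be a vertex). The void complex has no faces; the irrelevant complex is $\{\emptyset\}$. For $a\in X$, the deletion and link are the following simplicial complexes on the ground set $X\setminus\{a\}$: $\operatorname{dl}_a(\Delta)=\{\sigma\in\Delta: a\notin\sigma\}$ and $\operatorname{lk}_a(\Delta)=\{\sigma\in\Delta: a\notin\sigma,\ \sigma\cup\{a\}\in\Delta\}$. A complex on a ground set $Y$ is a cone with apex $x\in Y$ if it has the form $\{\sigma,\ \sigma\cup\{x\} : \sigma\in\Delta'\}$ for a simplicial complex $\Delta'$ none of whose faces contains $x$. In particular, the void complex is a cone with any apex $x\in Y$. Recursively, $(\Delta,X)$ is a strong combinatorial grape if either (i) there is $a\in X$ such that at least one of $\operatorname{lk}_a(\Delta)$ and $\operatorname{dl}_a(\Delta)$ is a cone, and both $\operatorname{dl}_a(\Delta)$ and $\operatorname{lk}_a(\Delta)$ are strong combinatorial grapes, or (ii) $\Delta$ has at most one vertex. Simple-homotopy: let $\sigma$ be a maximal face of $\Delta$ and $\tau\subset\sigma$ with $|\tau|=|\sigma|-1$ ($\tau=\emptyset$ is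 allowed). If $\sigma$ is the only face of $\Delta$ properly containing $\tau$, then the removal of $\sigma$ and $\tau$ is an elementary collapse; the inverse operation is an elementary expansion. Two simplicial complexes are simple-homotopy equivalent if they are related by a sequence of elementary collapses and elementary expansions. Here ground sets are disregarded: expansions may introduce new vertices, and complexes are considered up to isomorphism. $\partial\beta_n$ denotes the boundary of the $n$-dimensional cross-polytope: the join $S^0*\cdots*S^0$ of $n$ copies of $S^0=\{\emptyset,\{x\},\{y\}\}$ on pairwise disjoint vertex pairs; $\partial\beta_0$ is the irrelevant complex $\{\emptyset\}$. *)

theory Defs
  imports Main
begin

definition simplicial_complex :: "'a set set \<Rightarrow> 'a set \<Rightarrow> bool" where
  "simplicial_complex \<Delta> X \<longleftrightarrow>
     finite X \<and> \<Delta> \<subseteq> Pow X \<and> (\<forall>\<sigma>\<in>\<Delta>. \<forall>\<tau>. \<tau> \<subseteq> \<sigma> \<longrightarrow> \<tau> \<in> \<Delta>)"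

definition vertices :: "'a set set \<Rightarrow> 'a set" where
  "vertices \<Delta> = {x. {x} \<in> \<Delta>}"

definition deletion :: "'a \<Rightarrow> 'a set set \<Rightarrow> 'a set set" where
  "deletion a \<Delta> = {\<sigma> \<in> \<Delta>. a \<notin> \<sigma>}"

definition link :: "'a \<Rightarrow> 'a set set \<Rightarrow> 'a set set" where
  "link a \<Delta> = {\<sigma> \<in> \<Delta>. a \<notin> \<sigma> \<and> \<sigma> \<union> {a} \<in> \<Delta>}"

definition cone_with_apex :: "'a set set \<Rightarrow> 'a set \<Rightarrow> 'a \<Rightarrow> bool" where
  "cone_with_apex \<Delta> Y x \<longleftrightarrow> x \<in> Y \<and>
     (\<exists>\<Delta>'. simplicial_complex \<Delta>' Y \<and> (\<forall>\<sigma>\<in>\<Delta>'. x \<notin> \<sigma>) \<and>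
       \<Delta> = \<Delta>' \<union> {\<sigma> \<union> {x} | \<sigma>. \<sigma> \<in> \<Delta>'})"

text \<open>The apex ranges over the ground set, so the void complex is a cone exactly when
  the ground set is nonempty.\<close>

definition is_cone :: "'a set set \<Rightarrow> 'a set \<Rightarrow> bool" where
  "is_cone \<Delta> Y \<longleftrightarrow> (\<exists>x. cone_with_apex \<Delta> Y x)"

inductive strong_combinatorial_grape :: "'a set set \<Rightarrow> 'a set \<Rightarrow> bool" where
  split: "\<lbrakk>simplicial_complex \<Delta> X; a \<in> X;
      is_cone (link a \<Delta>) (X - {a}) \<or> is_cone (deletion a \<Delta>) (X - {a});
      strong_combinatorial_grape (deletion a \<Delta>) (X - {a});
      strong_combinatorial_grape (link a \<Delta>) (X - {a})\<rbrakk>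
    \<Longrightarrow> strong_combinatorial_grape \<Delta> X"
| at_most_one_vertex: "\<lbrakk>simplicial_complex \<Delta> X; card (vertices \<Delta>) \<le> 1\<rbrakk>
    \<Longrightarrow> strong_combinatorial_grape \<Delta> X"

text \<open>Here \<open>\<tau> = {}\<close> is allowed, so a one-vertex complex collapses to the void complex.\<close>

definition elementary_collapse :: "'a set set \<Rightarrow> 'a set set \<Rightarrow> bool" where
  "elementary_collapse \<Delta> \<Delta>' \<longleftrightarrow> (\<exists>X. simplicial_complex \<Delta> X) \<and>
     (\<exists>\<sigma> \<tau>. \<sigma> \<in> \<Delta> \<and> (\<forall>\<rho>\<in>\<Delta>. \<sigma> \<subseteq> \<rho> \<longrightarrow> \<rho> = \<sigma>) \<and>
        \<tau> \<subset> \<sigma> \<and> card \<sigma> = card \<tau> + 1 \<and>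
        (\<forall>\<rho>\<in>\<Delta>. \<tau> \<subset> \<rho> \<longrightarrow> \<rho> = \<sigma>) \<and>
        \<Delta>' = \<Delta> - {\<sigma>, \<tau>})"

text \<open>Isomorphism ignores elements of the ground set that lie in no face.\<close>

definition complex_iso :: "'a set set \<Rightarrow> 'b set set \<Rightarrow> bool" where
  "complex_iso \<Delta> \<Gamma> \<longleftrightarrow> (\<exists>f. inj_on f (\<Union>\<Delta>) \<and> \<Gamma> = (\<lambda>\<sigma>. f ` \<sigma>) ` \<Delta>)"

text \<open>The vertex type of \<open>\<Delta>\<close> may be finite, leaving no room for the new vertices of an
  expansion. Sequences of moves are therefore performed on isomorphic copies with vertices
  in \<^typ>\<open>nat\<close>, where every finite complex has a copy. The equivalence closure
  supplies the expansions as inverses of collapses.\<close>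

definition simple_homotopy_equivalent :: "'a set set \<Rightarrow> 'b set set \<Rightarrow> bool" where
  "simple_homotopy_equivalent \<Delta> \<Gamma> \<longleftrightarrow>
     (\<exists>\<Delta>' \<Gamma>' :: nat set set. complex_iso \<Delta> \<Delta>' \<and> complex_iso \<Gamma> \<Gamma>' \<and>
        equivclp (\<lambda>K L. elementary_collapse K L \<or> complex_iso K L) \<Delta>' \<Gamma>')"

text \<open>Meant for complexes whose vertex sets are disjoint.\<close>

definition complex_join :: "'a set set \<Rightarrow> 'a set set \<Rightarrow> 'a set set" where
  "complex_join \<Delta> \<Gamma> = {\<sigma> \<union> \<tau> | \<sigma> \<tau>. \<sigma> \<in> \<Delta> \<and> \<tau> \<in> \<Gamma>}"

definition zero_sphere :: "'a \<Rightarrow> 'a \<Rightarrow> 'a set set" where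
  "zero_sphere x y = {{}, {x}, {y}}"

text \<open>The \<open>i\<close>-th copy of the zero-sphere has vertices \<open>(i, False)\<close> and \<open>(i, True)\<close>.\<close>

primrec cross_polytope_boundary :: "nat \<Rightarrow> (nat \<times> bool) set set" where
  "cross_polytope_boundary 0 = {{}}"
| "cross_polytope_boundary (Suc n) =
     complex_join (cross_polytope_boundary n) (zero_sphere (n, False) (n, True))"

end

(* If the link of a is a cone, then \<Delta> collapses to the deletion of a. If the deletion D of a
   is a cone, then for a new vertex b the complex \<Delta> \<union> b * D collapses both to \<Delta> (matching along
   the apex of D) and to the suspension of the link of a (matching along b). Suspension respects
   simple homotopy and takes a cross-polytope boundary to the next one. *)

theory Submission
  imports Defs
begin

section \<open>Subcomplexes and collapses that match faces along a vertex\<close>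

lemma simplicial_complexD:
  assumes "simplicial_complex K X"
  shows "finite X" "\<sigma> \<in> K \<Longrightarrow> \<sigma> \<subseteq> X" "\<sigma> \<in> K \<Longrightarrow> \<tau> \<subseteq> \<sigma> \<Longrightarrow> \<tau> \<in> K"
  using assms unfolding simplicial_complex_def by blast+

lemma simplicial_complex_subset:
  assumes "simplicial_complex K X" "L \<subseteq> K" "\<And>\<sigma> \<tau>. \<sigma> \<in> L \<Longrightarrow> \<tau> \<subseteq> \<sigma> \<Longrightarrow> \<tau> \<in> L"
  shows "simplicial_complex L X"
  unfolding simplicial_complex_def
proof (intro conjI ballI allI impI)
  show "finite X" "L \<subseteq> Pow X"
    using assms(1,2) unfolding simplicial_complex_def by blast+
  show "\<tau> \<in> L" if "\<sigma> \<in> L" "\<tau> \<subseteq> \<sigma>" for \<sigma> \<tau>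
    using that by (rule assms(3))
qed

lemma simplicial_complex_Un:
  assumes "simplicial_complex K X" "simplicial_complex L Y"
  shows "simplicial_complex (K \<union> L) (X \<union> Y)"
proof -
  have "K \<union> L \<subseteq> Pow (X \<union> Y)" "finite (X \<union> Y)"
    using assms unfolding simplicial_complex_def by auto
  then show ?thesis
    using assms unfolding simplicial_complex_def by (metis Un_iff)
qed

text \<open>The faces outside \<open>L\<close> fall into pairs \<open>\<sigma>\<close>,
  \<open>\<tau> = \<sigma> - {x}\<close> with \<open>x \<in> \<sigma>\<close>. If
  \<open>\<sigma>\<close> has the largest size among them, then \<open>\<tau>\<close> is a free face
  of \<open>\<sigma>\<close>. Removing this pair is an elementary collapse and preserves all
  hypotheses, so induction on the number of faces outside \<open>L\<close> applies. Every collapse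
  in the development is obtained this way.\<close>

lemma collapses_along_vertex:
  assumes "simplicial_complex K X" "simplicial_complex L Y" "L \<subseteq> K"
    and "\<And>\<sigma>. \<sigma> \<in> K - L \<Longrightarrow> insert x \<sigma> \<in> K - L \<and> \<sigma> - {x} \<in> K - L"
  shows "elementary_collapse\<^sup>*\<^sup>* K L"
  using assms
proof (induction "card (K - L)" arbitrary: K rule: less_induct)
  case less
  note K = simplicial_complexD[OF less.prems(1)]
  note L = simplicial_complexD[OF less.prems(2)]
  note toggle = less.prems(4)
  have fin: "finite K"
    using less.prems(1) by (meson finite_Pow_iff finite_subset simplicial_complex_def)
  show ?case
  proof (cases "K - L = {}")
    case True
    then have "K = L" using less.prems(3) by blast
    then show ?thesis by simp
  next
    case False
    obtain \<sigma> where \<sigma>: "\<sigma> \<in> K - L" and max: "\<And>\<rho>. \<rho> \<in> K - L \<Longrightarrow> card \<rho> \<le> card \<sigma>"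
    proof -
      have "Max (card ` (K - L)) \<in> card ` (K - L)"
        using fin False by (intro Max_in) auto
      then obtain \<sigma> where "\<sigma> \<in> K - L" "card \<sigma> = Max (card ` (K - L))" by auto
      then show ?thesis using that fin by (metis Max_ge finite_Diff finite_imageI imageI)
    qed
    have finf: "finite \<rho>" if "\<rho> \<in> K" for \<rho>
      using K(1) K(2)[OF that] finite_subset by blast
    have eq: "\<rho> = \<sigma>" if "\<rho> \<in> K - L" "\<sigma> \<subseteq> \<rho>" for \<rho>
      using that max[of \<rho>] finf[of \<rho>] card_subset_eq[of \<rho> \<sigma>] card_mono[of \<rho> \<sigma>] by auto
    \<comment> \<open>Otherwise \<open>insert x \<sigma>\<close> would be a strictly larger face
      outside \<open>L\<close>.\<close>
    have x: "x \<in> \<sigma>"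
      using eq[of "insert x \<sigma>"] toggle[OF \<sigma>] by blast
    define \<tau> where "\<tau> = \<sigma> - {x}"
    have \<tau>: "\<tau> \<in> K - L" "\<sigma> = insert x \<tau>" "x \<notin> \<tau>"
      using toggle[OF \<sigma>] x unfolding \<tau>_def by auto
    \<comment> \<open>\<open>L\<close> is closed under subsets, so no face above
      \<open>\<tau>\<close> can lie in \<open>L\<close>.\<close>
    have above: "\<rho> \<in> K - L" if "\<rho> \<in> K" "\<tau> \<subseteq> \<rho>" for \<rho>
      using that \<tau>(1) L(3) by blast
    \<comment> \<open>Adding \<open>x\<close> to \<open>\<rho>\<close> gives a face containing
      \<open>\<sigma>\<close>, hence \<open>\<sigma>\<close> itself. So \<open>\<rho>\<close> lies
      between \<open>\<tau>\<close> and \<open>insert x \<tau>\<close>, and being different from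
      \<open>\<tau>\<close> it equals \<open>\<sigma>\<close>.\<close>
    have max_\<tau>: "\<rho> = \<sigma>" if "\<rho> \<in> K" "\<tau> \<subset> \<rho>" for \<rho>
    proof -
      have "\<rho> \<in> K - L" using above that by blast
      then have "insert x \<rho> = \<sigma>" using eq[of "insert x \<rho>"] toggle[of \<rho>] \<tau>(2) that by blast
      moreover obtain y where "y \<in> \<rho>" "y \<notin> \<tau>"
        using psubset_imp_ex_mem[OF \<open>\<tau> \<subset> \<rho>\<close>] by blast
      ultimately show ?thesis using \<tau>(2) by (metis insertCI insertE insert_absorb)
    qed
    have max_\<sigma>: "\<rho> = \<sigma>" if "\<rho> \<in> K" "\<sigma> \<subseteq> \<rho>" for \<rho>
      using max_\<tau> that \<tau> by blast
    let ?K' = "K - {\<sigma>, \<tau>}"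
    have step: "elementary_collapse K ?K'"
    proof -
      have "card \<sigma> = card \<tau> + 1" using \<tau> finf by auto
      moreover have "\<sigma> \<in> K" "\<tau> \<subset> \<sigma>" using \<sigma> \<tau> by auto
      moreover have "\<forall>\<rho>\<in>K. \<sigma> \<subseteq> \<rho> \<longrightarrow> \<rho> = \<sigma>" "\<forall>\<rho>\<in>K. \<tau> \<subset> \<rho> \<longrightarrow> \<rho> = \<sigma>"
        using max_\<sigma> max_\<tau> by blast+
      ultimately show ?thesis
        using less.prems(1) unfolding elementary_collapse_def by blast
    qed
    have "elementary_collapse\<^sup>*\<^sup>* ?K' L"
    proof (rule less.hyps)
      show "card (?K' - L) < card (K - L)"
        using fin \<sigma> by (intro psubset_card_mono) auto
      have "\<upsilon> \<in> ?K'" if "\<rho> \<in> ?K'" "\<upsilon> \<subseteq> \<rho>" for \<rho> \<upsilon>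
        using that K(3)[of \<rho> \<upsilon>] max_\<sigma>[of \<rho>] max_\<tau>[of \<rho>] by blast
      then show "simplicial_complex ?K' X"
        by (rule simplicial_complex_subset[OF less.prems(1) Diff_subset])
      \<comment> \<open>The removed faces are partners of each other, so the partner of a remaining
        face remains.\<close>
      show "insert x \<rho> \<in> ?K' - L \<and> \<rho> - {x} \<in> ?K' - L" if "\<rho> \<in> ?K' - L" for \<rho>
        using that toggle[of \<rho>] \<tau> by auto
    qed (use less.prems(2,3) \<sigma> \<tau> in auto)
    then show ?thesis using step by simp
  qed
qed

section \<open>Deletions, links and cones\<close>

lemma simplicial_complex_deletion:
  "simplicial_complex \<Delta> X \<Longrightarrow> simplicial_complex (deletion a \<Delta>) (X - {a})"
  unfolding simplicial_complex_def deletion_def by auto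

lemma simplicial_complex_link:
  assumes "simplicial_complex \<Delta> X"
  shows "simplicial_complex (link a \<Delta>) (X - {a})"
proof -
  have "\<tau> \<in> link a \<Delta>" if "\<sigma> \<in> link a \<Delta>" "\<tau> \<subseteq> \<sigma>" for \<sigma> \<tau>
    using that simplicial_complexD(3)[OF assms, of \<sigma> \<tau>]
      simplicial_complexD(3)[OF assms, of "\<sigma> \<union> {a}" "\<tau> \<union> {a}"]
    unfolding link_def by blast
  moreover have "link a \<Delta> \<subseteq> deletion a \<Delta>" unfolding link_def deletion_def by blast
  ultimately show ?thesis
    using simplicial_complex_subset[OF simplicial_complex_deletion[OF assms]] by metis
qed

text \<open>The base of the cone can always be taken to be the deletion of \<open>x\<close>. This
  replaces the existential in the definition by a closure condition, which is the form that matching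
  along \<open>x\<close> uses.\<close>

lemma cone_with_apex_iff:
  assumes "simplicial_complex K Y"
  shows "cone_with_apex K Y x \<longleftrightarrow> x \<in> Y \<and> (\<forall>\<sigma>\<in>K. insert x \<sigma> \<in> K)"
proof
  assume "cone_with_apex K Y x"
  then show "x \<in> Y \<and> (\<forall>\<sigma>\<in>K. insert x \<sigma> \<in> K)"
    unfolding cone_with_apex_def by fastforce
next
  assume R: "x \<in> Y \<and> (\<forall>\<sigma>\<in>K. insert x \<sigma> \<in> K)"
  have sub: "\<sigma> - {x} \<in> deletion x K" if "\<sigma> \<in> K" for \<sigma>
    using simplicial_complexD(3)[OF assms that, of "\<sigma> - {x}"] by (auto simp: deletion_def)
  have "K = deletion x K \<union> {\<sigma> \<union> {x} | \<sigma>. \<sigma> \<in> deletion x K}" (is "_ = ?R")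
  proof
    show "K \<subseteq> ?R"
    proof
      fix \<sigma> assume \<sigma>: "\<sigma> \<in> K"
      show "\<sigma> \<in> ?R"
      proof (cases "x \<in> \<sigma>")
        case True
        then have "\<sigma> = (\<sigma> - {x}) \<union> {x}" by blast
        then show ?thesis using sub[OF \<sigma>] by blast
      qed (use \<sigma> in \<open>simp add: deletion_def\<close>)
    qed
    show "?R \<subseteq> K" using R by (auto simp: deletion_def)
  qed
  moreover have "simplicial_complex (deletion x K) Y"
    using assms unfolding simplicial_complex_def deletion_def by auto
  ultimately show "cone_with_apex K Y x"
    unfolding cone_with_apex_def using R by (auto simp: deletion_def)
qed

section \<open>Transport along injections of the ground set\<close>

lemma simplicial_complex_image:
  assumes "simplicial_complex K X"
  shows "simplicial_complex ((`) f ` K) (f ` X)"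
proof -
  have "\<tau> \<in> (`) f ` K" if "\<sigma> \<in> K" "\<tau> \<subseteq> f ` \<sigma>" for \<sigma> \<tau>
    using that simplicial_complexD(3)[OF assms] by (metis imageI subset_imageE)
  moreover have "finite (f ` X)" "(`) f ` K \<subseteq> Pow (f ` X)"
    using simplicial_complexD(1,2)[OF assms] by auto
  ultimately show ?thesis unfolding simplicial_complex_def by (metis imageE)
qed

lemma is_cone_image:
  assumes "simplicial_complex K Y" "is_cone K Y"
  shows "is_cone ((`) f ` K) (f ` Y)"
proof -
  obtain x where x: "x \<in> Y" "\<And>\<sigma>. \<sigma> \<in> K \<Longrightarrow> insert x \<sigma> \<in> K"
    using assms cone_with_apex_iff unfolding is_cone_def by metis
  have "insert (f x) (f ` \<sigma>) \<in> (`) f ` K" if "\<sigma> \<in> K" for \<sigma>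
    using x(2)[OF that] by (metis image_insert imageI)
  then have "cone_with_apex ((`) f ` K) (f ` Y) (f x)"
    using x(1) by (subst cone_with_apex_iff[OF simplicial_complex_image[OF assms(1)]]) auto
  then show ?thesis unfolding is_cone_def by blast
qed

lemma deletion_image:
  assumes "simplicial_complex K X" "a \<in> X" "inj_on f X"
  shows "deletion (f a) ((`) f ` K) = (`) f ` deletion a K"
proof -
  have "f a \<in> f ` \<sigma> \<longleftrightarrow> a \<in> \<sigma>" if "\<sigma> \<in> K" for \<sigma>
    using inj_on_image_mem_iff[OF assms(3,2)] simplicial_complexD(2)[OF assms(1) that] by blast
  then show ?thesis unfolding deletion_def by auto
qed

lemma link_image:
  assumes "simplicial_complex K X" "a \<in> X" "inj_on f X"
  shows "link (f a) ((`) f ` K) = (`) f ` link a K"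
proof -
  have 1: "f a \<in> f ` \<sigma> \<longleftrightarrow> a \<in> \<sigma>" if "\<sigma> \<in> K" for \<sigma>
    using inj_on_image_mem_iff[OF assms(3,2)] simplicial_complexD(2)[OF assms(1) that] by blast
  have 2: "f ` \<sigma> \<union> {f a} \<in> (`) f ` K \<longleftrightarrow> \<sigma> \<union> {a} \<in> K" if "\<sigma> \<in> K" for \<sigma>
  proof -
    have eq: "f ` (\<sigma> \<union> {a}) = f ` \<sigma> \<union> {f a}" by auto
    \<comment> \<open>Both sets lie in \<open>X\<close>, where injectivity of \<open>f\<close> lets
      equality of images be cancelled.\<close>
    have "\<sigma> \<union> {a} = \<rho>" if "f ` (\<sigma> \<union> {a}) = f ` \<rho>" "\<rho> \<in> K" for \<rho>
      using that(1) inj_on_image_eq_iff[OF assms(3), of "\<sigma> \<union> {a}" \<rho>]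
        simplicial_complexD(2)[OF assms(1)] \<open>\<sigma> \<in> K\<close> that(2) assms(2) by auto
    then show ?thesis unfolding eq[symmetric] by blast
  qed
  have "f ` \<sigma> \<in> link (f a) ((`) f ` K) \<longleftrightarrow> \<sigma> \<in> link a K" if "\<sigma> \<in> K" for \<sigma>
    using 1[OF that] 2[OF that] that unfolding link_def by blast
  moreover have "link (f a) ((`) f ` K) \<subseteq> (`) f ` K" "link a K \<subseteq> K"
    unfolding link_def by auto
  ultimately show ?thesis by blast
qed

text \<open>Taking images commutes with deletion and link and preserves cones, so the recursion
  carries over. The purpose is to pass from an arbitrary vertex type to \<open>nat\<close>, where
  new vertices are always available. Injectivity is required on all of \<open>X\<close>, as the
  recursion may split at an element that is not a vertex.\<close>

lemma strong_combinatorial_grape_image: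
  assumes "strong_combinatorial_grape \<Delta> X" "inj_on f X"
  shows "strong_combinatorial_grape ((`) f ` \<Delta>) (f ` X)"
  using assms
proof (induction rule: strong_combinatorial_grape.induct)
  case (split \<Delta> X a)
  have X: "f ` X - {f a} = f ` (X - {a})"
    using split.prems split.hyps(2) by (auto simp: inj_on_def)
  have inj: "inj_on f (X - {a})"
    using split.prems by (rule inj_on_diff)
  show ?case
  proof (rule strong_combinatorial_grape.split[of _ _ "f a"])
    show "is_cone (link (f a) ((`) f ` \<Delta>)) (f ` X - {f a}) \<or>
        is_cone (deletion (f a) ((`) f ` \<Delta>)) (f ` X - {f a})"
      unfolding X link_image[OF split.hyps(1,2) split.prems]
        deletion_image[OF split.hyps(1,2) split.prems]
      using split.hyps(3) is_cone_image simplicial_complex_link[OF split.hyps(1)]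
        simplicial_complex_deletion[OF split.hyps(1)] by blast
    show "strong_combinatorial_grape (deletion (f a) ((`) f ` \<Delta>)) (f ` X - {f a})"
      unfolding X deletion_image[OF split.hyps(1,2) split.prems] using split.IH(1)[OF inj] .
    show "strong_combinatorial_grape (link (f a) ((`) f ` \<Delta>)) (f ` X - {f a})"
      unfolding X link_image[OF split.hyps(1,2) split.prems] using split.IH(2)[OF inj] .
  qed (use split.hyps(1,2) in \<open>simp_all add: simplicial_complex_image\<close>)
next
  case (at_most_one_vertex \<Delta> X)
  \<comment> \<open>A face with image \<open>{y}\<close> is nonempty, and any of its elements is a
    vertex mapped to \<open>y\<close>.\<close>
  have "y \<in> f ` vertices \<Delta>" if "{y} \<in> (`) f ` \<Delta>" for y
  proof -
    obtain \<sigma> where \<sigma>: "\<sigma> \<in> \<Delta>" "{y} = f ` \<sigma>" using \<open>{y} \<in> (`) f ` \<Delta>\<close> by blast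
    then obtain x where x: "x \<in> \<sigma>" "f x = y" by blast
    then have "{x} \<in> \<Delta>"
      using simplicial_complexD(3)[OF at_most_one_vertex.hyps(1) \<sigma>(1), of "{x}"] by blast
    then show ?thesis using x unfolding vertices_def by blast
  qed
  then have "vertices ((`) f ` \<Delta>) \<subseteq> f ` vertices \<Delta>" unfolding vertices_def by auto
  moreover have "vertices \<Delta> \<subseteq> X"
    using simplicial_complexD(2)[OF at_most_one_vertex.hyps(1)] unfolding vertices_def by blast
  then have "finite (vertices \<Delta>)"
    using simplicial_complexD(1)[OF at_most_one_vertex.hyps(1)] finite_subset by blast
  ultimately have "card (vertices ((`) f ` \<Delta>)) \<le> 1"
    using at_most_one_vertex.hyps(2) by (meson card_image_le card_mono finite_imageI le_trans)
  then show ?case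
    using at_most_one_vertex.hyps(1) simplicial_complex_image
      strong_combinatorial_grape.at_most_one_vertex by blast
qed

section \<open>Suspensions\<close>

text \<open>This is the join with the zero-sphere on \<open>a\<close> and \<open>b\<close>, in a
  form that can be unfolded into three families of faces. The suspension of the void complex is
  void, and \<open>suspension b b K\<close> is the cone over \<open>K\<close> with apex
  \<open>b\<close>.\<close>

definition suspension :: "'a \<Rightarrow> 'a \<Rightarrow> 'a set set \<Rightarrow> 'a set set" where
  "suspension a b K = K \<union> insert a ` K \<union> insert b ` K"

lemma complex_join_zero_sphere: "complex_join K (zero_sphere a b) = suspension a b K"
  unfolding complex_join_def zero_sphere_def suspension_def by auto

lemma suspension_iff:
  assumes "a \<noteq> b" "a \<notin> \<Union>K" "b \<notin> \<Union>K" "a \<notin> \<rho>" "b \<notin> \<rho>"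
  shows "\<rho> \<in> suspension a b K \<longleftrightarrow> \<rho> \<in> K"
    and "insert a \<rho> \<in> suspension a b K \<longleftrightarrow> \<rho> \<in> K"
    and "insert b \<rho> \<in> suspension a b K \<longleftrightarrow> \<rho> \<in> K"
proof -
  have fresh: "a \<notin> \<upsilon> \<and> b \<notin> \<upsilon>" if "\<upsilon> \<in> K" for \<upsilon> using that assms(2,3) by auto
  show "\<rho> \<in> suspension a b K \<longleftrightarrow> \<rho> \<in> K"
    using assms(4,5) unfolding suspension_def by auto
  \<comment> \<open>Stated for \<open>c\<close> and \<open>d\<close> so that it serves both
    suspension points: once with \<open>a\<close>, \<open>b\<close> and once with \<open>b\<close>,
    \<open>a\<close>.\<close>
  have strip: "\<rho> \<in> K" if mem: "insert c \<rho> \<in> K \<union> insert c ` K \<union> insert d ` K"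
    and "c \<noteq> d" "c \<notin> \<rho>" "d \<notin> \<rho>" and fresh: "\<forall>\<upsilon>\<in>K. c \<notin> \<upsilon>" for c d
  proof -
    have "insert c \<rho> \<notin> K" using fresh by blast
    moreover have "insert c \<rho> \<notin> insert d ` K"
      using \<open>c \<noteq> d\<close> \<open>d \<notin> \<rho>\<close> by (metis imageE insertE insertI1)
    ultimately obtain \<upsilon> where "\<upsilon> \<in> K" "insert c \<rho> = insert c \<upsilon>" using mem by blast
    then show ?thesis using \<open>c \<notin> \<rho>\<close> fresh insert_ident[of c \<rho> \<upsilon>] by simp
  qed
  show "insert a \<rho> \<in> suspension a b K \<longleftrightarrow> \<rho> \<in> K"
    using strip[of a b] fresh assms(1,4,5) unfolding suspension_def by blast
  show "insert b \<rho> \<in> suspension a b K \<longleftrightarrow> \<rho> \<in> K"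
    using strip[of b a] fresh assms(1,4,5) unfolding suspension_def by blast
qed

lemma simplicial_complex_suspension:
  assumes "simplicial_complex K X"
  shows "simplicial_complex (suspension a b K) (insert a (insert b X))"
proof -
  have "\<tau> \<in> K \<union> insert c ` K" if "\<sigma> \<in> K" "\<tau> \<subseteq> insert c \<sigma>" for \<sigma> \<tau> c
  proof (cases "c \<in> \<tau>")
    case True
    then have "\<tau> = insert c (\<tau> - {c})" by blast
    moreover have "\<tau> - {c} \<in> K" using that simplicial_complexD(3)[OF assms that(1)] by blast
    ultimately show ?thesis by blast
  next
    case False
    then show ?thesis using that simplicial_complexD(3)[OF assms that(1)] by blast
  qed
  note face = this
  have "\<tau> \<in> suspension a b K" if "\<sigma> \<in> suspension a b K" "\<tau> \<subseteq> \<sigma>" for \<sigma> \<tau>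
  proof -
    obtain \<rho> where "\<rho> \<in> K" "\<sigma> = \<rho> \<or> \<sigma> = insert a \<rho> \<or> \<sigma> = insert b \<rho>"
      using \<open>\<sigma> \<in> suspension a b K\<close> unfolding suspension_def by blast
    moreover from this have "\<tau> \<subseteq> insert a \<rho> \<or> \<tau> \<subseteq> insert b \<rho>" using \<open>\<tau> \<subseteq> \<sigma>\<close> by blast
    ultimately have "\<tau> \<in> K \<union> insert a ` K \<or> \<tau> \<in> K \<union> insert b ` K" using face by metis
    then show ?thesis unfolding suspension_def by blast
  qed
  moreover have "suspension a b K \<subseteq> Pow (insert a (insert b X))"
    using simplicial_complexD(2)[OF assms] unfolding suspension_def by blast
  moreover have "finite (insert a (insert b X))"
    using simplicial_complexD(1)[OF assms] by simp
  ultimately show ?thesis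
    unfolding simplicial_complex_def by metis
qed

text \<open>The isomorphism is extended by sending \<open>a\<close> to \<open>c\<close> and
  \<open>b\<close> to \<open>d\<close>. Freshness of \<open>a\<close> and \<open>b\<close> keeps it
  unchanged on the faces of \<open>K\<close>; freshness of \<open>c\<close> and \<open>d\<close>
  keeps it injective.\<close>

lemma complex_iso_suspension:
  assumes "complex_iso K L" "a \<noteq> b" "a \<notin> \<Union>K" "b \<notin> \<Union>K" "c \<noteq> d" "c \<notin> \<Union>L" "d \<notin> \<Union>L"
  shows "complex_iso (suspension a b K) (suspension c d L)"
proof -
  obtain f where f: "inj_on f (\<Union>K)" "L = (`) f ` K"
    using assms(1) unfolding complex_iso_def by auto
  define g where "g = f(a := c, b := d)"
  have fresh: "c \<notin> f ` \<Union>K" "d \<notin> f ` \<Union>K"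
    using assms(6,7) f(2) by auto
  have gab: "g a = c" "g b = d" using assms(2) by (simp_all add: g_def)
  have g: "g ` \<sigma> = f ` \<sigma>" if "\<sigma> \<in> K" for \<sigma>
    using that assms(3,4) unfolding g_def by (intro image_cong) auto
  have "inj_on g (insert a (insert b (\<Union>K)))"
    using f(1) fresh assms(2-5) by (auto simp: inj_on_def g_def)
  then have "inj_on g (\<Union>(suspension a b K))"
    by (rule inj_on_subset) (auto simp: suspension_def)
  moreover have "suspension c d L = (`) g ` suspension a b K"
    unfolding suspension_def f(2) image_Un image_image image_insert gab
    by (simp add: g cong: image_cong_simp)
  ultimately show ?thesis unfolding complex_iso_def by blast
qed

text \<open>Removing \<open>\<sigma>\<close> and \<open>\<tau>\<close> from \<open>K\<close> removes
  six faces from the suspension: these two, alone or enlarged by \<open>a\<close> or by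
  \<open>b\<close>. They form three pairs that differ in the single vertex \<open>x\<close> of
  \<open>\<sigma> - \<tau>\<close>, so one collapse becomes a sequence of collapses matched along
  \<open>x\<close>.\<close>

lemma suspension_collapses:
  assumes "elementary_collapse K L" "a \<noteq> b" "a \<notin> \<Union>K" "b \<notin> \<Union>K"
  shows "elementary_collapse\<^sup>*\<^sup>* (suspension a b K) (suspension a b L)"
proof -
  obtain X \<sigma> \<tau> where K: "simplicial_complex K X"
    and \<sigma>: "\<sigma> \<in> K" "\<And>\<rho>. \<rho> \<in> K \<Longrightarrow> \<sigma> \<subseteq> \<rho> \<Longrightarrow> \<rho> = \<sigma>"
    and \<tau>: "\<tau> \<subset> \<sigma>" "card \<sigma> = card \<tau> + 1" "\<And>\<rho>. \<rho> \<in> K \<Longrightarrow> \<tau> \<subset> \<rho> \<Longrightarrow> \<rho> = \<sigma>"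
    and L: "L = K - {\<sigma>, \<tau>}"
    using assms(1) unfolding elementary_collapse_def by blast
  have \<tau>K: "\<tau> \<in> K" using simplicial_complexD(3)[OF K] \<sigma> \<tau> by blast
  have "finite \<sigma>" using simplicial_complexD(1,2)[OF K] \<sigma>(1) finite_subset by metis
  then have "card (\<sigma> - \<tau>) = 1"
    using \<tau>(1,2) card_Diff_subset[of \<tau> \<sigma>] finite_subset[of \<tau> \<sigma>] by auto
  then obtain x where "\<sigma> - \<tau> = {x}" by (auto simp: card_1_singleton_iff)
  then have x: "\<sigma> = insert x \<tau>" "x \<notin> \<tau>" using \<tau>(1) by auto
  have "\<upsilon> \<in> L" if "\<rho> \<in> L" "\<upsilon> \<subseteq> \<rho>" for \<rho> \<upsilon>
    using that simplicial_complexD(3)[OF K, of \<rho> \<upsilon>] \<sigma>(2)[of \<rho>] \<tau>(3)[of \<rho>] unfolding L by blast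
  moreover have LK: "L \<subseteq> K" unfolding L by blast
  ultimately have L_complex: "simplicial_complex L X"
    using simplicial_complex_subset[OF K] by metis
  have fresh: "a \<notin> \<rho>" "b \<notin> \<rho>" if "\<rho> \<in> K" for \<rho>
    using that assms(3,4) by auto
  have xab: "x \<noteq> a" "x \<noteq> b" using fresh[OF \<sigma>(1)] x by auto
  have "a \<notin> \<Union>L" "b \<notin> \<Union>L" using assms(3,4) LK by auto
  note in_L = suspension_iff[OF assms(2) this, THEN iffD1]
  let ?R = "suspension a b K - suspension a b L"
  have removed: "\<upsilon> \<in> ?R \<and> insert a \<upsilon> \<in> ?R \<and> insert b \<upsilon> \<in> ?R" if "\<upsilon> = \<sigma> \<or> \<upsilon> = \<tau>" for \<upsilon>
  proof -
    have "\<upsilon> \<in> K" "\<upsilon> \<notin> L" using that \<sigma>(1) \<tau>K unfolding L by auto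
    then show ?thesis
      using in_L[of \<upsilon>] fresh[of \<upsilon>] unfolding suspension_def[of a b K] by blast
  qed
  have toggle: "insert x \<rho> \<in> ?R \<and> \<rho> - {x} \<in> ?R" if \<rho>: "\<rho> \<in> ?R" for \<rho>
  proof -
    obtain \<upsilon> where \<upsilon>: "\<upsilon> \<in> K" "\<upsilon> \<notin> L" "\<rho> = \<upsilon> \<or> \<rho> = insert a \<upsilon> \<or> \<rho> = insert b \<upsilon>"
      using \<rho> unfolding suspension_def by blast
    then have "\<upsilon> = \<sigma> \<or> \<upsilon> = \<tau>" unfolding L by blast
    then have x\<upsilon>: "insert x \<upsilon> = \<sigma>" "\<upsilon> - {x} = \<tau>" using x by auto
    have "insert x (insert c \<upsilon>) = insert c \<sigma>" for c
      using x\<upsilon>(1) by (metis insert_commute)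
    moreover have "insert c \<upsilon> - {x} = insert c \<tau>" if "x \<noteq> c" for c
      using x\<upsilon>(2) that by (simp add: insert_Diff_if)
    ultimately show ?thesis
      using \<upsilon>(3) x\<upsilon> xab removed[of \<sigma>] removed[of \<tau>] by metis
  qed
  have "suspension a b L \<subseteq> suspension a b K" using LK unfolding suspension_def by blast
  then show ?thesis
    using collapses_along_vertex[OF simplicial_complex_suspension[OF K]
        simplicial_complex_suspension[OF L_complex] _ toggle] by blast
qed

section \<open>Simple-homotopy moves and suspension over \<open>nat\<close>\<close>

abbreviation move :: "nat set set \<Rightarrow> nat set set \<Rightarrow> bool" where
  "move K L \<equiv> elementary_collapse K L \<or> complex_iso K L"

lemma collapses_imp_equivclp_move:
  assumes "elementary_collapse\<^sup>*\<^sup>* K L"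
  shows "equivclp move K L"
proof -
  have "elementary_collapse \<le> move" by auto
  then have "move\<^sup>*\<^sup>* K L" using assms rtranclp_mono by blast
  then show ?thesis by (rule rtranclp_into_equivclp)
qed

text \<open>Frees the numbers 0 and 1, so that they can serve as suspension points for every complex
  over \<open>nat\<close>.\<close>

definition shift :: "nat set set \<Rightarrow> nat set set" where
  "shift K = (`) (\<lambda>i. i + 2) ` K"

lemma shift_fresh: "0 \<notin> \<Union>(shift K)" "1 \<notin> \<Union>(shift K)"
  unfolding shift_def by auto

text \<open>Fixed suspension points make this a function of \<open>K\<close> alone, so it can be
  applied to each complex in a chain of moves without choosing points that are fresh for the whole
  chain.\<close>

definition nat_suspension :: "nat set set \<Rightarrow> nat set set" where
  "nat_suspension K = suspension 0 1 (shift K)"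

lemma complex_iso_shift:
  assumes "complex_iso K L"
  shows "complex_iso K (shift L)"
proof -
  obtain f where f: "inj_on f (\<Union>K)" "L = (`) f ` K"
    using assms unfolding complex_iso_def by auto
  have "inj_on (\<lambda>x. f x + 2) (\<Union>K)" using f(1) by (simp add: inj_on_def)
  moreover have "shift L = (`) (\<lambda>x. f x + 2) ` K"
    unfolding f(2) shift_def by (simp add: image_image)
  ultimately show ?thesis unfolding complex_iso_def by blast
qed

lemma complex_iso_nat_suspension:
  assumes "complex_iso K L" "a \<noteq> b" "a \<notin> \<Union>K" "b \<notin> \<Union>K"
  shows "complex_iso (suspension a b K) (nat_suspension L)"
  unfolding nat_suspension_def
  using assms complex_iso_shift shift_fresh by (intro complex_iso_suspension) auto

lemma complex_iso_image: "inj_on f (\<Union>K) \<Longrightarrow> complex_iso K ((`) f ` K)"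
  unfolding complex_iso_def by blast

text \<open>For a collapse, the suspension is taken at points \<open>a\<close>, \<open>b\<close>
  fresh for \<open>K\<close> itself, where \<open>suspension_collapses\<close> applies directly;
  isomorphisms link both ends to \<open>nat_suspension\<close>. For an isomorphism, the two
  suspensions are isomorphic.\<close>

lemma move_nat_suspension:
  assumes "move K L"
  shows "equivclp move (nat_suspension K) (nat_suspension L)"
proof -
  consider "elementary_collapse K L" | "complex_iso K L" using assms by blast
  then show ?thesis
  proof cases
    case 1
    then obtain X where "finite X" "K \<subseteq> Pow X" "L \<subseteq> K"
      unfolding elementary_collapse_def simplicial_complex_def by blast
    then have fin: "finite (\<Union>K)" and sub: "\<Union>L \<subseteq> \<Union>K"
      by (auto intro: finite_subset[of _ X])
    obtain a where a: "a \<notin> \<Union>K" using ex_new_if_finite[OF _ fin] by auto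
    obtain b where b: "b \<notin> insert a (\<Union>K)"
      using ex_new_if_finite[of "insert a (\<Union>K)"] fin by auto
    have refl: "complex_iso M M" for M :: "nat set set"
      using complex_iso_image[of id M] by simp
    have "equivclp move (nat_suspension K) (suspension a b K)"
      using a b by (intro converse_r_into_equivclp disjI2 complex_iso_nat_suspension refl) auto
    also have "equivclp move (suspension a b K) (suspension a b L)"
      using a b 1 by (intro collapses_imp_equivclp_move suspension_collapses) auto
    also have "equivclp move (suspension a b L) (nat_suspension L)"
      using a b sub by (intro r_into_equivclp disjI2 complex_iso_nat_suspension refl) auto
    finally show ?thesis .
  next
    case 2
    then obtain f where f: "inj_on f (\<Union>K)" "L = (`) f ` K"
      unfolding complex_iso_def by auto
    have "complex_iso (shift K) L"
      unfolding complex_iso_def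
      \<comment> \<open>Subtracting 2 undoes the shift before \<open>f\<close> is applied;
        truncation is harmless because all shifted vertices are at least 2.\<close>
      by (intro exI[of _ "\<lambda>i. f (i - 2)"])
        (use f in \<open>auto simp: shift_def image_image inj_on_def\<close>)
    then have "complex_iso (nat_suspension K) (nat_suspension L)"
      unfolding nat_suspension_def[of K]
      using shift_fresh by (intro complex_iso_nat_suspension) auto
    then show ?thesis by blast
  qed
qed

lemma equivclp_move_nat_suspension:
  "equivclp move K L \<Longrightarrow> equivclp move (nat_suspension K) (nat_suspension L)"
proof (induction rule: equivclp_induct)
  case (step L M)
  note step.IH
  \<comment> \<open>The last step of the chain may be a move in either direction.\<close>
  also have "equivclp move (nat_suspension L) (nat_suspension M)"
    using step.hyps(2) by (elim disjE[of "move L M"] move_nat_suspension equivclp_sym[OF move_nat_suspension])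
  finally show ?case .
qed simp

section \<open>Collapses obtained from a cone as link or as deletion\<close>

text \<open>The faces to be removed are those containing \<open>a\<close>, and without
  \<open>a\<close> they are exactly the faces of the link. They are therefore matched along the apex
  \<open>x\<close> of the link; since \<open>x \<noteq> a\<close>, toggling \<open>x\<close> never
  removes \<open>a\<close>.\<close>

lemma collapses_to_deletion:
  assumes "simplicial_complex \<Delta> X" "is_cone (link a \<Delta>) (X - {a})"
  shows "elementary_collapse\<^sup>*\<^sup>* \<Delta> (deletion a \<Delta>)"
proof -
  obtain x where x: "x \<noteq> a" "\<And>\<sigma>. \<sigma> \<in> link a \<Delta> \<Longrightarrow> insert x \<sigma> \<in> link a \<Delta>"
    using assms(2) cone_with_apex_iff[OF simplicial_complex_link[OF assms(1)]]
    unfolding is_cone_def by blast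
  show ?thesis
  proof (rule collapses_along_vertex[of _ X _ "X - {a}" x])
    fix \<sigma> assume "\<sigma> \<in> \<Delta> - deletion a \<Delta>"
    then have \<sigma>: "\<sigma> \<in> \<Delta>" "a \<in> \<sigma>" unfolding deletion_def by auto
    have sub: "\<sigma> - {c} \<in> \<Delta>" for c
      using simplicial_complexD(3)[OF assms(1) \<sigma>(1)] by blast
    have "\<sigma> - {a} \<in> link a \<Delta>"
      using \<sigma> sub unfolding link_def by (auto simp: insert_absorb)
    from x(2)[OF this] have "insert x (\<sigma> - {a}) \<union> {a} \<in> \<Delta>" unfolding link_def by blast
    moreover have "insert x (\<sigma> - {a}) \<union> {a} = insert x \<sigma>" using \<sigma>(2) by blast
    ultimately show "insert x \<sigma> \<in> \<Delta> - deletion a \<Delta> \<and> \<sigma> - {x} \<in> \<Delta> - deletion a \<Delta>"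
      using \<sigma>(2) sub x(1) unfolding deletion_def by auto
  qed (use assms simplicial_complex_deletion in \<open>auto simp: deletion_def\<close>)
qed

text \<open>Write \<open>D\<close> and \<open>L\<close> for the deletion and the link. The faces of
  \<open>M\<close> outside \<open>\<Delta>\<close> are those of \<open>D\<close> enlarged by
  \<open>b\<close>, matched along the apex of \<open>D\<close>. The faces of \<open>M\<close>
  outside the suspension of \<open>L\<close> are \<open>\<rho>\<close> and
  \<open>insert b \<rho>\<close> for \<open>\<rho>\<close> in \<open>D\<close> but not in
  \<open>L\<close>, matched along \<open>b\<close>.\<close>

lemma common_expansion_with_suspension_of_link:
  assumes \<Delta>: "simplicial_complex \<Delta> X" and "a \<in> X" "b \<notin> X"
    and "is_cone (deletion a \<Delta>) (X - {a})"
  defines "M \<equiv> \<Delta> \<union> insert b ` deletion a \<Delta>"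
  shows "elementary_collapse\<^sup>*\<^sup>* M \<Delta>"
    and "elementary_collapse\<^sup>*\<^sup>* M (suspension a b (link a \<Delta>))"
proof -
  let ?D = "deletion a \<Delta>" and ?L = "link a \<Delta>"
  have ab: "a \<noteq> b" using assms by blast
  have D: "simplicial_complex ?D (X - {a})" and L: "simplicial_complex ?L (X - {a})"
    by (rule simplicial_complex_deletion[OF \<Delta>], rule simplicial_complex_link[OF \<Delta>])
  have fresh: "b \<notin> \<sigma>" if "\<sigma> \<in> \<Delta>" for \<sigma>
    using simplicial_complexD(2)[OF \<Delta> that] assms(3) by blast
  have D\<Delta>: "?D \<subseteq> \<Delta>" and LD: "?L \<subseteq> ?D" unfolding deletion_def link_def by auto
  have aD: "a \<notin> \<sigma>" if "\<sigma> \<in> ?D" for \<sigma> using that unfolding deletion_def by auto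
  \<comment> \<open>With equal suspension points this is the cone over the deletion, so
    \<open>M\<close> is a union of two known complexes.\<close>
  have "M = \<Delta> \<union> suspension b b ?D" using D\<Delta> unfolding M_def suspension_def by blast
  then have M: "simplicial_complex M (X \<union> insert b (insert b (X - {a})))"
    using simplicial_complex_Un[OF \<Delta> simplicial_complex_suspension[OF D]] by (simp only:)
  obtain x where x: "x \<in> X" "\<And>\<sigma>. \<sigma> \<in> ?D \<Longrightarrow> insert x \<sigma> \<in> ?D"
    using assms(4) cone_with_apex_iff[OF D] unfolding is_cone_def by blast
  have xb: "x \<noteq> b" using x(1) assms(3) by blast
  have new: "insert b \<sigma> \<in> M - \<Delta>" if "\<sigma> \<in> ?D" for \<sigma>
    using that fresh unfolding M_def by blast
  show "elementary_collapse\<^sup>*\<^sup>* M \<Delta>"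
  proof (rule collapses_along_vertex[OF M \<Delta>, of x])
    fix \<sigma> assume "\<sigma> \<in> M - \<Delta>"
    then obtain \<rho> where \<rho>: "\<rho> \<in> ?D" "\<sigma> = insert b \<rho>" unfolding M_def by blast
    have "\<rho> - {x} \<in> ?D" using simplicial_complexD(3)[OF D \<rho>(1)] by blast
    then have "insert b (\<rho> - {x}) \<in> M - \<Delta>" by (rule new)
    moreover have "\<sigma> - {x} = insert b (\<rho> - {x})" using \<rho>(2) xb by auto
    moreover have "insert x \<sigma> = insert b (insert x \<rho>)" using \<rho>(2) by auto
    ultimately show "insert x \<sigma> \<in> M - \<Delta> \<and> \<sigma> - {x} \<in> M - \<Delta>"
      using new[OF x(2)[OF \<rho>(1)]] by simp
  qed (auto simp: M_def)
  have aL: "insert a \<sigma> \<in> \<Delta>" if "\<sigma> \<in> ?L" for \<sigma> using that unfolding link_def by auto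
  have out: "\<rho> \<in> M - suspension a b ?L \<and> insert b \<rho> \<in> M - suspension a b ?L"
    if "\<rho> \<in> ?D" "\<rho> \<notin> ?L" for \<rho>
  proof -
    have "a \<notin> \<Union>?L" "b \<notin> \<Union>?L" "b \<notin> \<rho>" "a \<notin> \<rho>"
      using that fresh aD LD D\<Delta> by auto
    then have "\<rho> \<notin> suspension a b ?L \<and> insert b \<rho> \<notin> suspension a b ?L"
      using that suspension_iff(1,3)[OF ab] by metis
    then show ?thesis using that D\<Delta> unfolding M_def by blast
  qed
  show "elementary_collapse\<^sup>*\<^sup>* M (suspension a b ?L)"
  proof (rule collapses_along_vertex[OF M simplicial_complex_suspension[OF L], where x = b])
    show "suspension a b ?L \<subseteq> M"
      using LD D\<Delta> aL unfolding suspension_def M_def by auto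
    fix \<sigma> assume \<sigma>: "\<sigma> \<in> M - suspension a b ?L"
    obtain \<rho> where \<rho>: "\<rho> \<in> ?D" "\<rho> \<notin> ?L" "\<sigma> = \<rho> \<or> \<sigma> = insert b \<rho>"
    proof (cases "\<sigma> \<in> \<Delta>")
      case True
      \<comment> \<open>A face of \<open>\<Delta>\<close> containing \<open>a\<close> is a face of
        the link enlarged by \<open>a\<close>, hence already in the suspension.\<close>
      have "a \<notin> \<sigma>"
      proof
        assume "a \<in> \<sigma>"
        then have eq: "\<sigma> = insert a (\<sigma> - {a})" by blast
        have "\<sigma> - {a} \<in> \<Delta>" using simplicial_complexD(3)[OF \<Delta> True] by blast
        then have "\<sigma> - {a} \<in> ?L" using True \<open>a \<in> \<sigma>\<close> unfolding link_def by (auto simp: insert_absorb)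
        then show False using \<sigma> eq unfolding suspension_def by blast
      qed
      then show ?thesis using that[of \<sigma>] True \<sigma> unfolding deletion_def suspension_def by blast
    next
      case False
      then obtain \<rho> where "\<rho> \<in> ?D" "\<sigma> = insert b \<rho>" using \<sigma> unfolding M_def by blast
      then show ?thesis using that[of \<rho>] \<sigma> unfolding suspension_def by blast
    qed
    then have "insert b \<sigma> = insert b \<rho>" "\<sigma> - {b} = \<rho>"
      using fresh D\<Delta> by auto
    then show "insert b \<sigma> \<in> M - suspension a b ?L \<and> \<sigma> - {b} \<in> M - suspension a b ?L"
      using out[OF \<rho>(1,2)] by simp
  qed
qed

section \<open>Cross-polytopes and the induction over grapes\<close>

text \<open>A copy of the cross-polytope boundary over \<open>nat\<close>, built so that suspending
  it yields the next one by definition.\<close>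

primrec nat_cross_polytope_boundary :: "nat \<Rightarrow> nat set set" where
  "nat_cross_polytope_boundary 0 = {{}}"
| "nat_cross_polytope_boundary (Suc n) = nat_suspension (nat_cross_polytope_boundary n)"

text \<open>Guarantees that the vertices \<open>(n, False)\<close> and \<open>(n, True)\<close>
  added at stage \<open>Suc n\<close> are fresh.\<close>

lemma Union_cross_polytope_boundary: "\<Union>(cross_polytope_boundary n) \<subseteq> {..<n} \<times> UNIV"
proof (induction n)
  case (Suc n)
  have "\<Union>(cross_polytope_boundary (Suc n)) \<subseteq>
      insert (n, False) (insert (n, True) (\<Union>(cross_polytope_boundary n)))"
    by (auto simp: complex_join_zero_sphere suspension_def)
  also have "\<dots> \<subseteq> {..<Suc n} \<times> UNIV" using Suc by auto
  finally show ?case .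
qed simp

lemma complex_iso_nat_cross_polytope_boundary:
  "complex_iso (cross_polytope_boundary n) (nat_cross_polytope_boundary n)"
proof (induction n)
  case 0
  show ?case by (simp add: complex_iso_def)
next
  case (Suc n)
  then show ?case
    using Union_cross_polytope_boundary[of n]
    by (auto simp: complex_join_zero_sphere intro!: complex_iso_nat_suspension)
qed

lemma nat_grape_equivclp_move:
  fixes \<Delta> :: "nat set set"
  assumes "strong_combinatorial_grape \<Delta> X"
  shows "equivclp move \<Delta> {} \<or> (\<exists>n. equivclp move \<Delta> (nat_cross_polytope_boundary n))"
  using assms
proof (induction rule: strong_combinatorial_grape.induct)
  case (split \<Delta> X a)
  show ?case
  proof (cases "is_cone (link a \<Delta>) (X - {a})")
    case True
    then have *: "equivclp move \<Delta> (deletion a \<Delta>)"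
      using split.hyps(1) by (intro collapses_imp_equivclp_move collapses_to_deletion)
    show ?thesis using split.IH(1) equivclp_trans[OF *] by blast
  next
    case False
    then have cone: "is_cone (deletion a \<Delta>) (X - {a})" using split.hyps(3) by blast
    obtain b where b: "b \<notin> X"
      using ex_new_if_finite[of X] simplicial_complexD(1)[OF split.hyps(1)] by auto
    note common = common_expansion_with_suspension_of_link[OF split.hyps(1,2) b cone]
    have "complex_iso (link a \<Delta>) (link a \<Delta>)"
      using complex_iso_image[of id "link a \<Delta>"] by simp
    then have iso: "complex_iso (suspension a b (link a \<Delta>)) (nat_suspension (link a \<Delta>))"
      using b split.hyps(2) simplicial_complexD(2)[OF simplicial_complex_link[OF split.hyps(1)]]
      by (intro complex_iso_nat_suspension) blast+
    note equivclp_sym[OF common(1)[THEN collapses_imp_equivclp_move]]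
    also note common(2)[THEN collapses_imp_equivclp_move]
    also have "equivclp move (suspension a b (link a \<Delta>)) (nat_suspension (link a \<Delta>))"
      using iso by (intro r_into_equivclp disjI2)
    finally have *: "equivclp move \<Delta> (nat_suspension (link a \<Delta>))" .
    note suspended = equivclp_trans[OF * equivclp_move_nat_suspension]
    from split.IH(2) show ?thesis
    proof
      assume "equivclp move (link a \<Delta>) {}"
      \<comment> \<open>The suspension of the void complex is again void.\<close>
      from suspended[OF this] show ?thesis
        by (simp add: nat_suspension_def shift_def suspension_def)
    next
      assume "\<exists>n. equivclp move (link a \<Delta>) (nat_cross_polytope_boundary n)"
      then obtain n where "equivclp move (link a \<Delta>) (nat_cross_polytope_boundary n)" ..
      from suspended[OF this] have "equivclp move \<Delta> (nat_cross_polytope_boundary (Suc n))"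
        by simp
      then show ?thesis by blast
    qed
  qed
next
  case (at_most_one_vertex \<Delta> X)
  note \<Delta> = simplicial_complexD[OF at_most_one_vertex.hyps(1)]
  have face: "\<sigma> \<subseteq> vertices \<Delta>" if "\<sigma> \<in> \<Delta>" for \<sigma>
    using \<Delta>(3)[OF that] unfolding vertices_def by blast
  have "vertices \<Delta> \<subseteq> X" using \<Delta>(2) unfolding vertices_def by blast
  \<comment> \<open>Finiteness is needed to read the bound on \<open>card\<close>, since infinite
    sets have \<open>card\<close> 0.\<close>
  then have "finite (vertices \<Delta>)" using \<Delta>(1) finite_subset by blast
  then consider "vertices \<Delta> = {}" | x where "vertices \<Delta> = {x}"
    using at_most_one_vertex.hyps(2) by (metis card_1_singletonE card_0_eq le_antisym less_one not_le)
  then show ?case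
  proof cases
    case 1
    \<comment> \<open>Without vertices the only possible face is the empty one, which leaves the
      void and the irrelevant complex.\<close>
    then have "\<Delta> = {} \<or> \<Delta> = nat_cross_polytope_boundary 0" using face by auto
    then show ?thesis
    proof
      assume "\<Delta> = {}"
      then show ?thesis by simp
    next
      assume "\<Delta> = nat_cross_polytope_boundary 0"
      then have "equivclp move \<Delta> (nat_cross_polytope_boundary 0)" by (simp only: equivclp_refl)
      then show ?thesis by blast
    qed
  next
    case 2
    \<comment> \<open>Here the complex consists of \<open>{}\<close> and \<open>{x}\<close>. They
      form one pair along \<open>x\<close>, so it collapses to the void complex with the empty set
      as free face.\<close>
    then have "insert x \<sigma> \<in> \<Delta> \<and> \<sigma> - {x} \<in> \<Delta>" if "\<sigma> \<in> \<Delta>" for \<sigma>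
    proof -
      have "{x} \<in> \<Delta>" using 2 unfolding vertices_def by blast
      moreover have "insert x \<sigma> = {x}" using face[OF that] 2 by blast
      ultimately show ?thesis using \<Delta>(3)[OF that] by (metis Diff_subset)
    qed
    moreover have "simplicial_complex ({} :: nat set set) {}" by (simp add: simplicial_complex_def)
    ultimately have "elementary_collapse\<^sup>*\<^sup>* \<Delta> {}"
      using collapses_along_vertex[OF at_most_one_vertex.hyps(1), of "{}" "{}" x] by auto
    then show ?thesis by (intro disjI1 collapses_imp_equivclp_move)
  qed
qed

theorem theorem4p3:
  fixes \<Delta> :: "'a set set" and X :: "'a set"
  assumes "strong_combinatorial_grape \<Delta> X"
  shows "simple_homotopy_equivalent \<Delta> ({} :: nat set set) \<or>
    (\<exists>n::nat. simple_homotopy_equivalent \<Delta> (cross_polytope_boundary n))"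
proof -
  have sc: "simplicial_complex \<Delta> X"
    using assms by cases auto
  \<comment> \<open>The finite ground set is embedded in \<open>nat\<close>; the image of
    \<open>\<Delta>\<close> is the isomorphic copy on which the moves are performed.\<close>
  then obtain f :: "'a \<Rightarrow> nat" where f: "inj_on f X"
    using finite_imp_inj_to_nat_seg simplicial_complexD(1) by metis
  moreover have "\<Union>\<Delta> \<subseteq> X" using simplicial_complexD(2)[OF sc] by blast
  ultimately have iso: "complex_iso \<Delta> ((`) f ` \<Delta>)"
    using complex_iso_image inj_on_subset by metis
  have void: "complex_iso ({} :: nat set set) ({} :: nat set set)"
    by (simp add: complex_iso_def)
  from nat_grape_equivclp_move[OF strong_combinatorial_grape_image[OF assms f]] show ?thesis
  proof
    assume "equivclp move ((`) f ` \<Delta>) {}"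
    with iso void have "simple_homotopy_equivalent \<Delta> ({} :: nat set set)"
      unfolding simple_homotopy_equivalent_def by (intro exI conjI)
    then show ?thesis ..
  next
    assume "\<exists>n. equivclp move ((`) f ` \<Delta>) (nat_cross_polytope_boundary n)"
    then obtain n where "equivclp move ((`) f ` \<Delta>) (nat_cross_polytope_boundary n)" ..
    with iso complex_iso_nat_cross_polytope_boundary
    have "simple_homotopy_equivalent \<Delta> (cross_polytope_boundary n)"
      unfolding simple_homotopy_equivalent_def by (intro exI conjI)
    then show ?thesis by (intro disjI2 exI)
  qed
qed

end
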